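(* Let $P$ be a topological directed set which is separable metrizable, in which down sets are compact and every convergent sequence has an upper bound. If a space $X$ has a $P$-point finite almost subbase then it has a $(P\times\mathbb N)$-point finite expandable network.
   Context: All spaces are Tychonoff (completely regular Hausdorff). $\mathbb N=\{1,2,\dots\}$ with its usual order; products of directed sets carry the product order. A directed set is a partially ordered set in which any two elements have an upper bound. A topological directed set is a directed set equipped with a topology. Down sets are the sets $\{q\in P:q\le p\}$, $p\in P$. `Every convergent sequence has an upper bound' means that for every convergent sequence in $P$ there is an element of $P$ above all its terms. A (co)zero set of $X$ is the (co)zero set of some continuous $f:X\to[0,1]$. A $U$-representation of $V\subseteq X$ is a sequence $U(V)=\{U_n(V):n\in\mathbb N\}$ with $V=\bigcup_n U_n(V)$, $U_n(V)\subseteq U_{n+1}(V)$, $U_{2n-1}(V)$ a zero set and $U_{2n}(V)$ a cozero set for all $n$. A family $\alpha$ of subsets of $X$ is an almost subbase if one can choose $U$-representations $U(V)$, $V\in\alpha$, such that $\alpha\cup\{X\setminus U_{2n-1}(V):V\in\alpha,n\in\mathbb N\}$ is a subbase of $X$. An expandable network for $X$ is a collection $\mathcal N$ of pairs $(N,V)$ of subsets of $X$ with $N\subseteq V$ and $V$ open, such that whenever $x\in U$, $U$ open, there is $(N,V)\in\mathcal N$ with $x\in N\subseteq U$. For a directed set $Q$, a collection $\mathcal C$ of subsets of $X$ (respectively of pairs of subsets) is $Q$-point finite if $\mathcal C=\bigcup_{q\in Q}\mathcal C_q$ with $\mathcal C_q\subseteq\mathcal C_{q'}$ whenever $q\le q'$,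 and for all $q\in Q$, $x\in X$ the set $\{C\in\mathcal C_q:x\in C\}$ (respectively $\{(C_1,C_2)\in\mathcal C_q:x\in C_2\}$) is finite. *)

theory Defs
  imports "HOL-Analysis.Analysis"
begin

definition Tychonoff_space :: "'a topology \<Rightarrow> bool" where
  "Tychonoff_space X \<longleftrightarrow> completely_regular_space X \<and> Hausdorff_space X"

text \<open>Directed sets are given by a carrier and an order relation, a set of pairs on that
  carrier; \<open>(p, q) \<in> r\<close> means \<open>p \<le> q\<close>. The carrier may be empty.\<close>

definition directed_set_on :: "'p set \<Rightarrow> 'p rel \<Rightarrow> bool" where
  "directed_set_on D r \<longleftrightarrow>
     partial_order_on D r \<and> (\<forall>p\<in>D. \<forall>q\<in>D. \<exists>u\<in>D. (p, u) \<in> r \<and> (q, u) \<in> r)"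

definition topological_directed_set :: "'p topology \<Rightarrow> 'p rel \<Rightarrow> bool" where
  "topological_directed_set P r \<longleftrightarrow> directed_set_on (topspace P) r"

definition down_set :: "'p rel \<Rightarrow> 'p \<Rightarrow> 'p set" where
  "down_set r p = {q. (q, p) \<in> r}"

definition convergent_sequences_bounded :: "'p topology \<Rightarrow> 'p rel \<Rightarrow> bool" where
  "convergent_sequences_bounded P r \<longleftrightarrow>
     (\<forall>s::nat \<Rightarrow> 'p. range s \<subseteq> topspace P \<and> (\<exists>l. limitin P s l sequentially) \<longrightarrow>
        (\<exists>p\<in>topspace P. \<forall>n. (s n, p) \<in> r))"

definition product_order :: "'p rel \<Rightarrow> 'q rel \<Rightarrow> ('p \<times> 'q) rel" where
  "product_order r s = {((p, q), (p', q')). (p, p') \<in> r \<and> (q, q') \<in> s}"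

definition pos_nat_order :: "nat rel" where
  "pos_nat_order = relation_of (\<le>) {1..}"

definition zero_set_in :: "'a topology \<Rightarrow> 'a set \<Rightarrow> bool" where
  "zero_set_in X Z \<longleftrightarrow>
     (\<exists>f. continuous_map X (top_of_set {0..1::real}) f \<and> Z = {x \<in> topspace X. f x = 0})"

definition cozero_set_in :: "'a topology \<Rightarrow> 'a set \<Rightarrow> bool" where
  "cozero_set_in X C \<longleftrightarrow>
     (\<exists>f. continuous_map X (top_of_set {0..1::real}) f \<and> C = {x \<in> topspace X. f x \<noteq> 0})"

text \<open>Sequences are indexed by the positive integers; the value \<open>U 0\<close> is ignored.\<close>

definition U_representation :: "'a topology \<Rightarrow> 'a set \<Rightarrow> (nat \<Rightarrow> 'a set) \<Rightarrow> bool" where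
  "U_representation X V U \<longleftrightarrow>
     V = (\<Union>n\<in>{1..}. U n) \<and>
     (\<forall>n\<ge>1. U n \<subseteq> U (n + 1)) \<and>
     (\<forall>n\<ge>1. zero_set_in X (U (2 * n - 1)) \<and> cozero_set_in X (U (2 * n)))"

text \<open>A subbase of \<open>X\<close> is a family generating the topology of \<open>X\<close>, and it covers \<open>X\<close>. For a
  nonempty \<open>\<alpha>\<close> the covering condition is automatic below, since
  \<open>V \<union> (topspace X - U V 1) = topspace X\<close>.\<close>

definition almost_subbase :: "'a topology \<Rightarrow> 'a set set \<Rightarrow> bool" where
  "almost_subbase X \<alpha> \<longleftrightarrow>
     (\<exists>U. (\<forall>V\<in>\<alpha>. U_representation X V (U V)) \<and>
          X = topology_generated_by
                (\<alpha> \<union> {topspace X - U V (2 * n - 1) | V n. V \<in> \<alpha> \<and> n \<ge> 1}))"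

definition expandable_network :: "'a topology \<Rightarrow> ('a set \<times> 'a set) set \<Rightarrow> bool" where
  "expandable_network X \<N> \<longleftrightarrow>
     (\<forall>(N, V)\<in>\<N>. N \<subseteq> V \<and> openin X V) \<and>
     (\<forall>x U. openin X U \<and> x \<in> U \<longrightarrow> (\<exists>(N, V)\<in>\<N>. x \<in> N \<and> N \<subseteq> U))"

definition point_finite_sets :: "'q set \<Rightarrow> 'q rel \<Rightarrow> 'a topology \<Rightarrow> 'a set set \<Rightarrow> bool" where
  "point_finite_sets Q r X \<C> \<longleftrightarrow>
     (\<exists>F. \<C> = (\<Union>q\<in>Q. F q) \<and>
          (\<forall>q\<in>Q. \<forall>q'\<in>Q. (q, q') \<in> r \<longrightarrow> F q \<subseteq> F q') \<and>
          (\<forall>q\<in>Q. \<forall>x\<in>topspace X. finite {C \<in> F q. x \<in> C}))"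

definition point_finite_pairs ::
  "'q set \<Rightarrow> 'q rel \<Rightarrow> 'a topology \<Rightarrow> ('a set \<times> 'a set) set \<Rightarrow> bool" where
  "point_finite_pairs Q r X \<C> \<longleftrightarrow>
     (\<exists>F. \<C> = (\<Union>q\<in>Q. F q) \<and>
          (\<forall>q\<in>Q. \<forall>q'\<in>Q. (q, q') \<in> r \<longrightarrow> F q \<subseteq> F q') \<and>
          (\<forall>q\<in>Q. \<forall>x\<in>topspace X. finite {(C1, C2). (C1, C2) \<in> F q \<and> x \<in> C2}))"

end

theory Submission
  imports Defs
begin

text \<open>
  Write the almost subbase as the increasing union of point-finite families \<open>F p\<close>, \<open>p \<in> P\<close>. A basic
  neighbourhood of a point \<open>x\<close> uses finitely many members \<open>V\<close> of the almost subbase and finitely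
  many sets \<open>X - U\<^sub>j(W)\<close>, and all these \<open>V\<close> and \<open>W\<close> lie in one \<open>F p\<close>. The difficulty is the
  \<open>W\<close> that do not contain \<open>x\<close>: the complement of \<open>U\<^sub>j(W)\<close> is a large set, with no small open
  expansion related to \<open>W\<close>. The remedy is to record only the finite trace
  \<open>T = {V \<in> F p. x \<in> V}\<close>. The set of all \<open>y\<close> with the same trace misses every \<open>W \<in> F p - T\<close>
  entirely, and each \<open>W \<in> T\<close> contributes finitely many further conditions \<open>y \<notin> U\<^sub>j(W)\<close>. The
  resulting set is contained in the open set \<open>\<Inter>T\<close>, and a given point lies in \<open>\<Inter>T\<close> for only
  finitely many \<open>T \<subseteq> F q\<close>.

  However, the trace depends on \<open>p\<close>, and a layer belonging to \<open>q\<close> would have to admit all the possibly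
  uncountably many \<open>p \<le> q\<close>. So \<open>p\<close> is replaced by a member \<open>B\<close> of a countable base of \<open>P\<close>, and
  \<open>F p\<close> by \<open>\<Union>p\<in>B. F p\<close>, whose index can be bounded by the factor \<open>\<nat>\<close>. This larger family need
  not be point-finite, but for fixed \<open>x\<close> and \<open>p\<close> the trace of \<open>x\<close> on it is finite as soon as \<open>B\<close> is
  a sufficiently small neighbourhood of \<open>p\<close>: otherwise there is a sequence in \<open>P\<close> converging to
  \<open>p\<close> that collects infinitely many different members containing \<open>x\<close>, and an upper bound \<open>u\<close> of
  the sequence contradicts the point-finiteness of \<open>F u\<close>. This is
  \<open>locally_finite_union_of_bounded_sequences\<close>.
\<close>

section \<open>Countable bases and convergent sequences\<close>

lemma separable_metrizable_imp_second_countable: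
  assumes "separable_space P" "metrizable_space P"
  shows "second_countable P"
proof -
  obtain M d where "Metric_space M d" and P: "P = Metric_space.mtopology M d"
    using assms(2) by (auto simp: metrizable_space_def)
  interpret Metric_space M d by fact
  obtain C where C: "countable C" "C \<subseteq> M" "P closure_of C = M"
    using assms(1) by (auto simp: separable_space_def P)
  let ?B = "(\<lambda>(c, n). mball c (inverse (Suc n))) ` (C \<times> (UNIV :: nat set))"
  have "\<exists>V\<in>?B. x \<in> V \<and> V \<subseteq> U" if U: "openin P U" "x \<in> U" for U x
  proof -
    obtain e where e: "e > 0" "mball x e \<subseteq> U" and xM: "x \<in> M"
      using U unfolding P openin_mtopology by blast
    obtain n where n: "inverse (real (Suc n)) < e / 2"
      using reals_Archimedean[of "e / 2"] e(1) by auto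
    have "x \<in> P closure_of C" using C(3) xM by simp
    moreover have "inverse (real (Suc n)) > 0" by simp
    ultimately obtain c where c: "c \<in> C" "c \<in> mball x (inverse (Suc n))"
      unfolding P metric_closure_of by blast
    have "mball c (inverse (Suc n)) \<subseteq> mball x e"
    proof
      fix y assume y: "y \<in> mball c (inverse (Suc n))"
      have "d x y \<le> d x c + d c y" using y c xM by (auto intro: triangle)
      then show "y \<in> mball x e" using y c n xM by auto
    qed
    then have "mball c (inverse (Suc n)) \<subseteq> U" using e(2) by simp
    moreover have "x \<in> mball c (inverse (Suc n))"
      using c by (auto simp: commute)
    moreover have "mball c (inverse (Suc n)) \<in> ?B"
      using c(1) by (intro image_eqI[where x = "(c, n)"]) auto
    ultimately show ?thesis by (intro bexI[of _ "mball c (inverse (Suc n))"] conjI)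
  qed
  moreover have "countable ?B" using C(1) by auto
  moreover have "\<forall>V\<in>?B. openin P V" by (auto simp: P)
  ultimately show ?thesis unfolding second_countable_def by (intro exI[of _ ?B]) simp
qed

lemma infinite_sets_imp_injective_choice:
  fixes A :: "nat \<Rightarrow> 'b set"
  assumes "\<And>n. infinite (A n)"
  obtains v where "inj v" "\<And>n. v n \<in> A n"
proof -
  have "\<exists>v. \<forall>n. v n \<in> A n \<and> v n \<notin> v ` {..<n}"
  proof (rule dependent_wellorder_choice)
    fix n :: nat and f :: "nat \<Rightarrow> 'b"
    have "\<not> A n \<subseteq> f ` {..<n}" using assms finite_subset by blast
    then show "\<exists>a. a \<in> A n \<and> a \<notin> f ` {..<n}" by blast
  qed (auto simp: image_iff)
  then obtain v where v: "\<And>n. v n \<in> A n \<and> v n \<notin> v ` {..<n}" by blast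
  have "inj v"
    by (rule linorder_injI) (metis v imageI lessThan_iff)
  with v that show thesis by blast
qed

lemma first_countable_sequence_base:
  assumes "first_countable P" "p \<in> topspace P"
  obtains W where "\<And>n::nat. openin P (W n)" "\<And>n. p \<in> W n"
    "\<And>s. (\<And>n. s n \<in> W n) \<Longrightarrow> limitin P s p sequentially"
proof -
  obtain \<B> where \<B>: "countable \<B>" "\<And>V. V \<in> \<B> \<Longrightarrow> openin P V"
    "\<And>U. openin P U \<Longrightarrow> p \<in> U \<Longrightarrow> \<exists>V\<in>\<B>. p \<in> V \<and> V \<subseteq> U"
    using assms(1)[unfolded first_countable_def, rule_format, OF assms(2)]
    by (elim exE conjE) blast
  define b where "b = from_nat_into \<B>"
  define W where "W n = topspace P \<inter> \<Inter>{B \<in> b ` {..n} \<inter> \<B>. p \<in> B}" for n :: nat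
  show thesis
  proof
    show "openin P (W n)" for n
      unfolding W_def by (rule openin_Int_Inter) (auto simp: \<B>(2))
    show "p \<in> W n" for n
      using assms(2) by (auto simp: W_def)
    fix s assume s: "\<And>n. s n \<in> W n"
    have "\<exists>N. \<forall>n\<ge>N. s n \<in> U" if U: "openin P U" "p \<in> U" for U
    proof -
      obtain V where V: "V \<in> \<B>" "p \<in> V" "V \<subseteq> U" using \<B>(3) U by blast
      then obtain N where N: "b N = V"
        using \<B>(1) from_nat_into_surj unfolding b_def by metis
      have "W n \<subseteq> V" if "n \<ge> N" for n
        using V N that unfolding W_def by blast
      then show ?thesis using s V(3) by blast
    qed
    then show "limitin P s p sequentially"
      using assms(2) by (auto simp: limitin_sequentially)
  qed
qed

text \<open>If the union were infinite over every neighbourhood of \<open>p\<close>, pairwise different elements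
  \<open>v n \<in> G (s n)\<close> could be chosen along a sequence \<open>s\<close> converging to \<open>p\<close>; an upper bound of \<open>s\<close>
  then has an infinite value under \<open>G\<close>. It is applied to the sets of members of \<open>F q\<close> that contain
  a fixed point.\<close>

lemma locally_finite_union_of_bounded_sequences:
  assumes "first_countable P" "convergent_sequences_bounded P r"
    and mono: "\<And>q q'. q \<in> topspace P \<Longrightarrow> q' \<in> topspace P \<Longrightarrow> (q, q') \<in> r \<Longrightarrow> G q \<subseteq> G q'"
    and fin: "\<And>q. q \<in> topspace P \<Longrightarrow> finite (G q)"
    and p: "p \<in> topspace P"
  obtains W where "openin P W" "p \<in> W" "finite (\<Union>q\<in>W. G q)"
proof -
  obtain W where W: "\<And>n::nat. openin P (W n)" "\<And>n. p \<in> W n"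
    "\<And>s. (\<And>n. s n \<in> W n) \<Longrightarrow> limitin P s p sequentially"
    using first_countable_sequence_base assms(1) p by metis
  have "\<exists>n. finite (\<Union>q\<in>W n. G q)"
  proof (rule ccontr)
    assume "\<nexists>n. finite (\<Union>q\<in>W n. G q)"
    then obtain v where v: "inj v" "\<And>n. v n \<in> (\<Union>q\<in>W n. G q)"
      using infinite_sets_imp_injective_choice[of "\<lambda>n. \<Union>q\<in>W n. G q"] by blast
    then obtain s where s: "\<And>n. s n \<in> W n" "\<And>n. v n \<in> G (s n)"
      by simp metis
    have sP: "s n \<in> topspace P" for n
      using s(1) W(1) openin_subset by blast
    obtain u where u: "u \<in> topspace P" "\<And>n. (s n, u) \<in> r"
      using assms(2) W(3)[OF s(1)] sP unfolding convergent_sequences_bounded_def by blast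
    have "range v \<subseteq> G u"
      using s(2) mono[OF sP u(1) u(2)] by blast
    then have "finite (range v)" using fin[OF u(1)] finite_subset by blast
    then show False using v(1) finite_imageD by blast
  qed
  then show thesis using that W by blast
qed

section \<open>Subbases and directed unions\<close>

lemma topology_generated_by_finite_Inter:
  assumes "openin (topology_generated_by S) U" "x \<in> U"
  obtains \<F> where "finite \<F>" "\<F> \<noteq> {}" "\<F> \<subseteq> S" "x \<in> \<Inter>\<F>" "\<Inter>\<F> \<subseteq> U"
proof -
  have "generate_topology_on S U" using assms(1) by (simp add: openin_topology_generated_by_iff)
  then have "\<forall>x\<in>U. \<exists>\<F>. finite \<F> \<and> \<F> \<noteq> {} \<and> \<F> \<subseteq> S \<and> x \<in> \<Inter>\<F> \<and> \<Inter>\<F> \<subseteq> U"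
  proof induction
    case Empty
    then show ?case by simp
  next
    case (Int a b)
    show ?case
    proof
      fix x assume "x \<in> a \<inter> b"
      then have "x \<in> a" "x \<in> b" by auto
      obtain \<F> where \<F>: "finite \<F>" "\<F> \<noteq> {}" "\<F> \<subseteq> S" "x \<in> \<Inter>\<F>" "\<Inter>\<F> \<subseteq> a"
        using bspec[OF Int.IH(1) \<open>x \<in> a\<close>] by (elim exE conjE)
      obtain \<G> where \<G>: "finite \<G>" "\<G> \<noteq> {}" "\<G> \<subseteq> S" "x \<in> \<Inter>\<G>" "\<Inter>\<G> \<subseteq> b"
        using bspec[OF Int.IH(2) \<open>x \<in> b\<close>] by (elim exE conjE)
      show "\<exists>\<F>. finite \<F> \<and> \<F> \<noteq> {} \<and> \<F> \<subseteq> S \<and> x \<in> \<Inter>\<F> \<and> \<Inter>\<F> \<subseteq> a \<inter> b"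
        by (rule exI[of _ "\<F> \<union> \<G>"]) (use \<F> \<G> in \<open>auto simp: Inter_Un_distrib\<close>)
    qed
  next
    case (UN K)
    then show ?case by (meson Union_iff Union_upper order_trans)
  next
    case (Basis s)
    then have "finite {s} \<and> {s} \<noteq> {} \<and> {s} \<subseteq> S \<and> \<Inter>{s} \<subseteq> s" by simp
    then show ?case by (intro ballI exI[of _ "{s}"]) simp
  qed
  then show thesis using assms(2) that by blast
qed

lemma finite_subset_directed_Union:
  assumes "directed_set_on D r" "D \<noteq> {}"
    and mono: "\<And>q q'. q \<in> D \<Longrightarrow> q' \<in> D \<Longrightarrow> (q, q') \<in> r \<Longrightarrow> F q \<subseteq> F q'"
    and "finite A" "A \<subseteq> (\<Union>q\<in>D. F q)"
  obtains q where "q \<in> D" "A \<subseteq> F q"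
proof -
  have "\<exists>q\<in>D. A \<subseteq> F q"
    using assms(4,5)
  proof (induction A)
    case empty
    then show ?case using assms(2) by blast
  next
    case (insert a A)
    then obtain p q where pq: "p \<in> D" "A \<subseteq> F p" "q \<in> D" "a \<in> F q" by auto
    then obtain u where "u \<in> D" "(p, u) \<in> r" "(q, u) \<in> r"
      using assms(1) unfolding directed_set_on_def by blast
    then have "insert a A \<subseteq> F u" "u \<in> D" using pq mono[of p u] mono[of q u] by auto
    then show ?case by blast
  qed
  then show thesis using that by blast
qed

section \<open>Pairs determined by traces\<close>

text \<open>The sets to be avoided are recorded by their indices \<open>(V, j)\<close>, so that for finite \<open>T\<close> a bound on
  \<open>j\<close> leaves only finitely many \<open>S \<subseteq> T \<times> \<nat>\<close>.\<close>

definition trace_cell ::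
    "'a topology \<Rightarrow> ('a set \<Rightarrow> nat \<Rightarrow> 'a set) \<Rightarrow> 'a set set \<Rightarrow> 'a set set \<Rightarrow> ('a set \<times> nat) set \<Rightarrow> 'a set" where
  "trace_cell X U \<beta> T S =
     {y \<in> topspace X. {V \<in> \<beta>. y \<in> V} = T \<and> (\<forall>(V, j)\<in>S. y \<notin> U V j)}"

text \<open>The pairs in one layer of the network: \<open>\<gamma>\<close> is the point-finite family belonging to the
  \<open>P\<close>-coordinate of the layer and controls the expansions, while the \<open>\<nat>\<close>-coordinate \<open>k\<close> leaves
  finitely many \<open>(m, S)\<close> for each \<open>T\<close>. The families \<open>\<beta> m\<close> may be larger than \<open>\<gamma>\<close>.\<close>

definition trace_layer ::
    "'a topology \<Rightarrow> ('a set \<Rightarrow> nat \<Rightarrow> 'a set) \<Rightarrow> (nat \<Rightarrow> 'a set set) \<Rightarrow> 'a set set \<Rightarrow> nat \<Rightarrow> ('a set \<times> 'a set) set" where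
  "trace_layer X U \<beta> \<gamma> k =
     {(trace_cell X U (\<beta> m) T S, topspace X \<inter> \<Inter>T) | m T S.
        m \<le> k \<and> finite T \<and> T \<subseteq> \<gamma> \<and> S \<subseteq> T \<times> {..k}}"

lemma trace_layer_mono:
  assumes "\<gamma> \<subseteq> \<gamma>'" "k \<le> k'"
  shows "trace_layer X U \<beta> \<gamma> k \<subseteq> trace_layer X U \<beta> \<gamma>' k'"
proof -
  have "T \<times> {..k} \<subseteq> T \<times> {..k'}" for T :: "'a set set" using assms(2) by auto
  then show ?thesis
    using assms unfolding trace_layer_def by (blast intro: order_trans)
qed

lemma trace_layer_point_finite:
  assumes "finite {V \<in> \<gamma>. x \<in> V}"
  shows "finite {(N, V). (N, V) \<in> trace_layer X U \<beta> \<gamma> k \<and> x \<in> V}"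
proof -
  let ?E = "{V \<in> \<gamma>. x \<in> V}"
  have "{(N, V). (N, V) \<in> trace_layer X U \<beta> \<gamma> k \<and> x \<in> V} \<subseteq>
      (\<lambda>(m, T, S). (trace_cell X U (\<beta> m) T S, topspace X \<inter> \<Inter>T)) `
        ({..k} \<times> Pow ?E \<times> Pow (?E \<times> {..k}))"
  proof (clarsimp simp: trace_layer_def)
    fix m T S
    assume *: "m \<le> k" "T \<subseteq> \<gamma>" "S \<subseteq> T \<times> {..k}" "\<forall>V\<in>T. x \<in> V"
    then have "T \<subseteq> ?E" by blast
    then have "(m, T, S) \<in> {..k} \<times> Pow ?E \<times> Pow (?E \<times> {..k})" using * by blast
    then show "(trace_cell X U (\<beta> m) T S, topspace X \<inter> \<Inter>T) \<in>
      (\<lambda>(m, T, S). (trace_cell X U (\<beta> m) T S, topspace X \<inter> \<Inter>T)) `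
        ({..k} \<times> Pow ?E \<times> Pow (?E \<times> {..k}))"
      by (rule rev_image_eqI) simp
  qed
  moreover have "finite ({..k} \<times> Pow ?E \<times> Pow (?E \<times> {..k}))" using assms by simp
  ultimately show ?thesis by (meson finite_imageI finite_subset)
qed

lemma trace_layer_expansion:
  assumes "(N, V) \<in> trace_layer X U \<beta> \<gamma> k" "\<And>W. W \<in> \<gamma> \<Longrightarrow> openin X W"
  shows "N \<subseteq> V" "openin X V"
proof -
  obtain m T S where *: "N = trace_cell X U (\<beta> m) T S" "V = topspace X \<inter> \<Inter>T" "finite T" "T \<subseteq> \<gamma>"
    using assms(1) unfolding trace_layer_def by blast
  show "N \<subseteq> V" unfolding * trace_cell_def by auto
  show "openin X V" unfolding * using *(3,4) assms(2) by (intro openin_Int_Inter) auto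
qed

text \<open>A set \<open>topspace X - U V j\<close> with \<open>x \<notin> V\<close> need not be recorded in \<open>S\<close>: having the trace of \<open>x\<close>
  already excludes all of \<open>V\<close>, which contains \<open>U V j\<close>. Hence \<open>S\<close> can be restricted to members of
  the trace.\<close>

lemma trace_cell_subset_basic_neighbourhood:
  assumes "A \<subseteq> \<beta>" "S \<subseteq> \<beta> \<times> UNIV" "x \<in> \<Inter>A" "\<And>V j. (V, j) \<in> S \<Longrightarrow> U V j \<subseteq> V"
    and T: "T = {V \<in> \<beta>. x \<in> V}"
    and y: "y \<in> trace_cell X U \<beta> T (S \<inter> T \<times> UNIV)"
  shows "y \<in> \<Inter>(A \<union> (\<lambda>(V, j). topspace X - U V j) ` S)"
proof
  fix G assume "G \<in> A \<union> (\<lambda>(V, j). topspace X - U V j) ` S"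
  then consider "G \<in> A" | V j where "(V, j) \<in> S" "G = topspace X - U V j" by auto
  then show "y \<in> G"
  proof cases
    case 1
    then have "G \<in> T" using assms(1,3) T by auto
    then show ?thesis using y by (auto simp: trace_cell_def)
  next
    case 2
    have "y \<notin> U V j"
    proof (cases "V \<in> T")
      case True
      then show ?thesis using y 2(1) by (auto simp: trace_cell_def)
    next
      case False
      then have "y \<notin> V" using y 2(1) assms(2) by (auto simp: trace_cell_def)
      then show ?thesis using assms(4) 2(1) by blast
    qed
    then show ?thesis using y 2(2) by (simp add: trace_cell_def)
  qed
qed

section \<open>The network\<close>

text \<open>The countable base of \<open>P\<close> serves twice: its enumeration supplies the indices \<open>m\<close> bounded by the
  factor \<open>\<nat>\<close>, and it contains neighbourhoods of \<open>p\<close> small enough to make the trace of a given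
  point finite. The two directedness arguments are separate: one collects a basic neighbourhood
  in a single \<open>F p\<close>, the other places the resulting trace in a single \<open>F q\<close>.\<close>

theorem expandable_network_of_point_finite_almost_subbase:
  fixes P :: "'p topology" and r :: "'p rel" and X :: "'a topology"
  assumes dir: "topological_directed_set P r"
    and sc: "second_countable P"
    and bdd: "convergent_sequences_bounded P r"
    and sub: "almost_subbase X \<alpha>" and pf: "point_finite_sets (topspace P) r X \<alpha>"
  shows "\<exists>\<N>. expandable_network X \<N> \<and>
           point_finite_pairs (topspace P \<times> {1..}) (product_order r pos_nat_order) X \<N>"
proof -
  obtain F where F: "\<alpha> = (\<Union>q\<in>topspace P. F q)"
    and mono: "\<And>q q'. q \<in> topspace P \<Longrightarrow> q' \<in> topspace P \<Longrightarrow> (q, q') \<in> r \<Longrightarrow> F q \<subseteq> F q'"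
    and fin: "\<And>q x. q \<in> topspace P \<Longrightarrow> x \<in> topspace X \<Longrightarrow> finite {C \<in> F q. x \<in> C}"
    using pf unfolding point_finite_sets_def by metis
  have dirP: "directed_set_on (topspace P) r"
    using dir by (simp add: topological_directed_set_def)
  obtain U where U: "\<And>V. V \<in> \<alpha> \<Longrightarrow> U_representation X V (U V)"
    and X: "X = topology_generated_by
              (\<alpha> \<union> {topspace X - U V (2 * n - 1) | V n. V \<in> \<alpha> \<and> n \<ge> 1})"
    using sub unfolding almost_subbase_def by blast
  define J where "J = {(V, 2 * n - 1) | V n. V \<in> \<alpha> \<and> n \<ge> (1::nat)}"
  define co where "co = (\<lambda>(V, j). topspace X - U V j)"
  have "{topspace X - U V (2 * n - 1) | V n. V \<in> \<alpha> \<and> n \<ge> 1} = co ` J"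
    unfolding J_def co_def by (auto simp: image_iff)
  with X have X: "X = topology_generated_by (\<alpha> \<union> co ` J)" by simp
  have J: "V \<in> \<alpha>" "U V j \<subseteq> V" if "(V, j) \<in> J" for V j
  proof -
    obtain n where n: "V \<in> \<alpha>" "j = 2 * n - 1" "n \<ge> 1" using \<open>(V, j) \<in> J\<close> by (auto simp: J_def)
    then show "V \<in> \<alpha>" by simp
    have "V = (\<Union>n\<in>{1..}. U V n)" using U[OF n(1)] by (simp add: U_representation_def)
    moreover have "j \<in> {1..}" using n by simp
    ultimately show "U V j \<subseteq> V" by blast
  qed
  have \<alpha>_open: "openin X V" if "V \<in> \<alpha>" for V
    using topology_generated_by_Basis[of V "\<alpha> \<union> co ` J"] that X by simp
  obtain \<B> where \<B>: "countable \<B>" "\<And>B. B \<in> \<B> \<Longrightarrow> openin P B"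
    "\<And>W p. openin P W \<Longrightarrow> p \<in> W \<Longrightarrow> \<exists>B\<in>\<B>. p \<in> B \<and> B \<subseteq> W"
    using sc unfolding second_countable_def by metis
  define \<beta> where "\<beta> m = (\<Union>q\<in>from_nat_into \<B> m. F q)" for m
  define C where "C = (\<lambda>(q, k). trace_layer X U \<beta> (F q) k)"
  let ?N = "\<Union>a\<in>topspace P \<times> {1..}. C a"
  have "expandable_network X ?N"
    unfolding expandable_network_def
  proof (intro conjI allI impI)
    have "N \<subseteq> V \<and> openin X V" if mem: "(N, V) \<in> ?N" for N V
    proof -
      obtain q k where "q \<in> topspace P" and NV: "(N, V) \<in> trace_layer X U \<beta> (F q) k"
        using mem by (auto simp: C_def)
      then have "openin X W" if "W \<in> F q" for W
        using that \<alpha>_open F by blast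
      then show ?thesis using trace_layer_expansion[OF NV] by simp
    qed
    then show "\<forall>(N, V)\<in>?N. N \<subseteq> V \<and> openin X V" by blast
    fix x O' assume "openin X O' \<and> x \<in> O'"
    then have "openin (topology_generated_by (\<alpha> \<union> co ` J)) O'" "x \<in> O'" using X by simp_all
    then obtain \<F> where \<F>: "finite \<F>" "\<F> \<noteq> {}" "\<F> \<subseteq> \<alpha> \<union> co ` J" "x \<in> \<Inter>\<F>" "\<Inter>\<F> \<subseteq> O'"
      using topology_generated_by_finite_Inter by metis
    have xX: "x \<in> topspace X"
      using \<open>openin X O' \<and> x \<in> O'\<close> openin_subset by blast
    define A where "A = \<F> \<inter> \<alpha>"
    have "finite (\<F> - \<alpha>)" "\<F> - \<alpha> \<subseteq> co ` J" using \<F> by auto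
    then obtain S where S: "S \<subseteq> J" "finite S" "\<F> - \<alpha> = co ` S"
      using finite_subset_image by meson
    have \<F>_eq: "\<F> = A \<union> co ` S" using S(3) by (auto simp: A_def)
    have subA: "A \<union> fst ` S \<subseteq> (\<Union>q\<in>topspace P. F q)"
      unfolding F[symmetric] using S(1) J(1) by (force simp: A_def)
    have "\<alpha> \<noteq> {}" using \<F>(2,3) by (auto simp: J_def)
    then have ne: "topspace P \<noteq> {}" unfolding F by blast
    have finA: "finite (A \<union> fst ` S)" using S(2) \<F>(1) by (simp add: A_def)
    then obtain p where p: "p \<in> topspace P" "A \<union> fst ` S \<subseteq> F p"
      using finite_subset_directed_Union[where F = F, OF dirP ne mono finA subA] by blast
    obtain W where W: "openin P W" "p \<in> W" "finite (\<Union>q\<in>W. {V \<in> F q. x \<in> V})"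
    proof (rule locally_finite_union_of_bounded_sequences[OF second_countable_imp_first_countable[OF sc] bdd])
      show "{V \<in> F q. x \<in> V} \<subseteq> {V \<in> F q'. x \<in> V}"
        if "q \<in> topspace P" "q' \<in> topspace P" "(q, q') \<in> r" for q q'
        using mono[OF that] by blast
      show "finite {V \<in> F q. x \<in> V}" if "q \<in> topspace P" for q
        using fin[OF that xX] .
    qed (use p in auto)
    obtain B where B: "B \<in> \<B>" "p \<in> B" "B \<subseteq> W" using \<B>(3)[OF W(1,2)] by blast
    define m where "m = to_nat_on \<B> B"
    have \<beta>m: "\<beta> m = (\<Union>q\<in>B. F q)" using B(1) \<B>(1) by (simp add: \<beta>_def m_def)
    define T where "T = {V \<in> \<beta> m. x \<in> V}"
    have "T \<subseteq> (\<Union>q\<in>W. {V \<in> F q. x \<in> V})" using B(3) unfolding T_def \<beta>m by blast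
    then have finT: "finite T" using W(3) finite_subset by blast
    have "B \<subseteq> topspace P" using \<B>(2)[OF B(1)] openin_subset by blast
    then have "T \<subseteq> (\<Union>q\<in>topspace P. F q)" unfolding T_def \<beta>m by blast
    \<comment> \<open>The layer of \<open>T\<close> is in general not that of \<open>p\<close>: members of \<open>T\<close> come from all of \<open>B\<close>.\<close>
    then obtain q where q: "q \<in> topspace P" "T \<subseteq> F q"
      using finite_subset_directed_Union[where F = F, OF dirP ne mono finT] by blast
    obtain l where l: "snd ` S \<subseteq> {..l}"
      using S(2) finite_nat_iff_bounded_le by blast
    define k where "k = Suc (max m l)"
    define N where "N = trace_cell X U (\<beta> m) T (S \<inter> T \<times> UNIV)"
    have "j \<le> k" if "(V, j) \<in> S" for V j
    proof -
      have "j \<in> snd ` S" using that by force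
      then have "j \<le> l" using l by auto
      then show ?thesis by (simp add: k_def)
    qed
    then have "S \<inter> T \<times> UNIV \<subseteq> T \<times> {..k}" by auto
    moreover have "m \<le> k" by (simp add: k_def)
    ultimately have "(N, topspace X \<inter> \<Inter>T) \<in> C (q, k)"
      using finT q(2) unfolding C_def N_def trace_layer_def prod.case by blast
    moreover have "(q, k) \<in> topspace P \<times> {1..}" using q(1) by (simp add: k_def)
    ultimately have inN: "(N, topspace X \<inter> \<Inter>T) \<in> ?N" by blast
    have "x \<notin> U V j" if "(V, j) \<in> S" for V j
    proof -
      have "co (V, j) \<in> \<F>" using that \<F>_eq by blast
      then have "x \<in> co (V, j)" using \<F>(4) by blast
      then show ?thesis by (simp add: co_def)
    qed
    then have "x \<in> N" using xX unfolding N_def trace_cell_def T_def by blast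
    moreover have "N \<subseteq> \<Inter>\<F>"
    proof
      fix y assume y: "y \<in> N"
      have "F p \<subseteq> \<beta> m" using B(2) \<beta>m by blast
      then have A: "A \<subseteq> \<beta> m" and "fst ` S \<subseteq> \<beta> m" using p(2) by (simp_all add: order_trans[of _ "F p"])
      then have SS: "S \<subseteq> \<beta> m \<times> UNIV" by (auto simp: image_subset_iff)
      have xA: "x \<in> \<Inter>A" using \<F>(4) by (auto simp: A_def)
      have "U V j \<subseteq> V" if "(V, j) \<in> S" for V j
        using that J(2) S(1) by blast
      from trace_cell_subset_basic_neighbourhood[OF A SS xA this T_def y[unfolded N_def]]
      show "y \<in> \<Inter>\<F>" unfolding \<F>_eq co_def .
    qed
    ultimately show "\<exists>(N, V)\<in>?N. x \<in> N \<and> N \<subseteq> O'" using inN \<F>(5)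
      by (intro bexI[OF _ inN]) simp
  qed
  moreover have "point_finite_pairs (topspace P \<times> {1..}) (product_order r pos_nat_order) X ?N"
    unfolding point_finite_pairs_def
  proof (intro exI conjI ballI impI)
    show "?N = ?N" ..
    show "C a \<subseteq> C a'"
      if "a \<in> topspace P \<times> {1..}" "a' \<in> topspace P \<times> {1..}" "(a, a') \<in> product_order r pos_nat_order"
      for a a'
    proof -
      obtain q k q' k' where a: "a = (q, k)" "a' = (q', k')" by (metis surj_pair)
      have "F q \<subseteq> F q'" using that mono[of q q'] by (auto simp: a product_order_def)
      moreover have "k \<le> k'"
        using that by (auto simp: a product_order_def pos_nat_order_def relation_of_def)
      ultimately show ?thesis unfolding C_def a by (simp add: trace_layer_mono)
    qed
    show "finite {(C1, C2). (C1, C2) \<in> C a \<and> x \<in> C2}"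
      if "a \<in> topspace P \<times> {1..}" "x \<in> topspace X" for a x
    proof -
      obtain q k where a: "a = (q, k)" by (metis surj_pair)
      then have "q \<in> topspace P" using that(1) by simp
      then show ?thesis
        using trace_layer_point_finite[OF fin[OF _ that(2)]] by (simp add: C_def a)
    qed
  qed
  ultimately show ?thesis by blast
qed

theorem theorem34:
  fixes P :: "'p topology" and r :: "'p rel" and X :: "'a topology"
  assumes "topological_directed_set P r"
    and "separable_space P" and "metrizable_space P"
    and "\<And>p. p \<in> topspace P \<Longrightarrow> compactin P (down_set r p)"
    and "convergent_sequences_bounded P r"
    and "Tychonoff_space X"
    and "\<exists>\<alpha>. almost_subbase X \<alpha> \<and> point_finite_sets (topspace P) r X \<alpha>"
  shows "\<exists>\<N>. expandable_network X \<N> \<and>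
           point_finite_pairs (topspace P \<times> {1..}) (product_order r pos_nat_order) X \<N>"
proof -
  obtain \<alpha> where "almost_subbase X \<alpha>" "point_finite_sets (topspace P) r X \<alpha>"
    using assms(7) by (elim exE conjE)
  with assms(1,5) separable_metrizable_imp_second_countable[OF assms(2,3)] show ?thesis
    by (intro expandable_network_of_point_finite_almost_subbase)
qed

end
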